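(* Let $n,s,k$ be positive integers. If $k>s+1$, then the number of facets of $P_{n,k,s}$ is $(s+2)(n-1)+k$. If $1<k\le s+1$, then the number of facets of $P_{n,k,s}$ is $kn$.
   Context: For positive integers $n,k,s$ let $K=s(n-1)+k$ and let $e_0,\ldots,e_{K-1}$ be the standard basis of $\mathbb{R}^{K}$. For $0\le i\le n-1$ let $\lambda_i=\{si,si+1,\ldots,si+k-1\}$ and $\Delta_{\lambda_i}=\operatorname{conv}\{e_j: j\in\lambda_i\}$. Then $P_{n,k,s}=\sum_{i=0}^{n-1}\Delta_{\lambda_i}$ (Minkowski sum). A facet is a face of dimension $\dim(P_{n,k,s})-1$. *)

theory Defs
  imports "HOL-Analysis.Analysis" "HOL-Library.Set_Algebras"
begin

text \<open>
  Coordinates of \<open>\<real>\<^sup>K\<close> are indexed by a finite type \<open>'m\<close>; a bijection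
  \<open>v\<close> from \<open>{..<K}\<close> to \<open>'m\<close> numbers them \<open>0, \<dots>, K - 1\<close>, so that
  \<open>std_basis v 0, \<dots>, std_basis v (K - 1)\<close> is the standard basis.
\<close>

definition std_basis :: "(nat \<Rightarrow> 'm) \<Rightarrow> nat \<Rightarrow> real ^ 'm::finite" where
  "std_basis v j = axis (v j) 1"

definition lam :: "nat \<Rightarrow> nat \<Rightarrow> nat \<Rightarrow> nat set" where
  "lam k s i = {s * i ..< s * i + k}"

definition coord_simplex :: "(nat \<Rightarrow> 'm) \<Rightarrow> nat set \<Rightarrow> (real ^ 'm::finite) set" where
  "coord_simplex v L = convex hull (std_basis v ` L)"

text \<open>
  The sum is the Minkowski sum: addition of sets is that of
  \<^theory>\<open>HOL-Library.Set_Algebras\<close>.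
\<close>

definition P_poly :: "(nat \<Rightarrow> 'm) \<Rightarrow> nat \<Rightarrow> nat \<Rightarrow> nat \<Rightarrow> (real ^ 'm::finite) set" where
  "P_poly v n k s = (\<Sum>i<n. coord_simplex v (lam k s i))"

end

theory Submission
  imports Defs
begin

text \<open>
  A facet of a polytope is the set of minimizers of a linear functional \<open>w\<close>, and by counting dimensions
  such a face is a facet iff every functional constant on the face is a multiple of \<open>w\<close> plus a
  functional constant on the whole polytope. For a Minkowski sum of simplices, being constant on the
  face of \<open>w\<close> means being constant, for each summand, on the vertices where \<open>w\<close> is minimal. So the
  facets correspond to weights on \<open>{..<K}\<close>, up to positive scaling and addition of weights constant
  on every \<open>\<lambda>\<^sub>i\<close>, satisfying a combinatorial rigidity condition.

  For \<open>k \<le> s + 1\<close> consecutive \<open>\<lambda>\<^sub>i\<close> share at most one index, so a weight can be prescribed on each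
  \<open>\<lambda>\<^sub>i\<close> independently up to constants (the polytope is a product of \<open>n\<close> simplices), and facets
  correspond to pairs of an \<open>i\<close> and an element of \<open>\<lambda>\<^sub>i\<close>. For \<open>k > s + 1\<close> a rigid weight is
  equivalent to the indicator of a set \<open>S\<close>; rigidity forces \<open>S\<close> to be a singleton, a proper prefix
  \<open>\<lambda>\<^sub>0 \<union> \<dots> \<union> \<lambda>\<^sub>b\<close> or a proper suffix \<open>\<lambda>\<^sub>a \<union> \<dots> \<union> \<lambda>\<^bsub>n-1\<^esub>\<close>.
\<close>

section \<open>Facets of Minkowski sums of convex hulls\<close>

text \<open>Stated for arbitrary real functions, so that it serves both for linear functionals on a
  polytope and for weights on an index set.\<close>

definition minimizers :: "('a \<Rightarrow> real) \<Rightarrow> 'a set \<Rightarrow> 'a set" where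
  "minimizers f X = {x \<in> X. \<forall>y\<in>X. f x \<le> f y}"

text \<open>For nonempty \<open>X\<close> this is the orthogonal complement of the linear space
  parallel to the affine hull of \<open>X\<close>.\<close>

definition constant_directions :: "'a::real_inner set \<Rightarrow> 'a set" where
  "constant_directions X = {u. \<forall>x\<in>X. \<forall>y\<in>X. u \<bullet> x = u \<bullet> y}"

lemma constant_directionsI:
  "(\<And>x y. x \<in> X \<Longrightarrow> y \<in> X \<Longrightarrow> u \<bullet> x = u \<bullet> y) \<Longrightarrow> u \<in> constant_directions X"
  unfolding constant_directions_def by blast

lemma constant_directionsD:
  "u \<in> constant_directions X \<Longrightarrow> x \<in> X \<Longrightarrow> y \<in> X \<Longrightarrow> u \<bullet> x = u \<bullet> y"
  unfolding constant_directions_def by blast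

lemma minimizers_subset: "minimizers f X \<subseteq> X"
  by (auto simp: minimizers_def)

lemma minimizers_nonempty:
  fixes w :: "'a::real_inner"
  assumes "compact X" "X \<noteq> {}"
  shows "minimizers ((\<bullet>) w) X \<noteq> {}"
proof -
  have "continuous_on X ((\<bullet>) w)"
    by (intro continuous_intros)
  from continuous_attains_inf[OF assms this] show ?thesis
    by (auto simp: minimizers_def)
qed

lemma subspace_constant_directions: "subspace (constant_directions X)"
proof (rule subspaceI)
  show "0 \<in> constant_directions X" by (simp add: constant_directionsI)
next
  fix u u' assume u: "u \<in> constant_directions X" "u' \<in> constant_directions X"
  have "(u + u') \<bullet> x = (u + u') \<bullet> y" if "x \<in> X" "y \<in> X" for x y
    using u[THEN constant_directionsD, OF that] by (simp add: inner_add_left)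
  then show "u + u' \<in> constant_directions X" by (rule constant_directionsI)
next
  fix c u assume u: "u \<in> constant_directions X"
  have "(c *\<^sub>R u) \<bullet> x = (c *\<^sub>R u) \<bullet> y" if "x \<in> X" "y \<in> X" for x y
    using u[THEN constant_directionsD, OF that] by simp
  then show "c *\<^sub>R u \<in> constant_directions X" by (rule constant_directionsI)
qed

lemma span_constant_directions [simp]: "span (constant_directions X) = constant_directions X"
  using subspace_constant_directions by (simp add: span_eq_iff)

lemma constant_directions_antimono:
  "X \<subseteq> Y \<Longrightarrow> constant_directions Y \<subseteq> constant_directions X"
  unfolding constant_directions_def by blast

text \<open>Translating a point of \<open>X\<close> to the origin turns the constant directions into
  the orthogonal complement of the span, and the dimension of that span is the affine
  dimension.\<close>

lemma aff_dim_plus_dim_constant_directions: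
  fixes X :: "'a::euclidean_space set"
  assumes "X \<noteq> {}"
  shows "aff_dim X + int (dim (constant_directions X)) = int DIM('a)"
proof -
  obtain a where a: "a \<in> X" using assms by blast
  let ?D = "(+) (- a) ` X"
  have "constant_directions X = {y. \<forall>x\<in>?D. orthogonal x y}" (is "_ = ?O")
  proof (intro equalityI subsetI)
    fix u assume "u \<in> ?O"
    then have "u \<bullet> x = u \<bullet> a" if "x \<in> X" for x
      using that by (simp add: orthogonal_def inner_diff_left inner_commute[of _ u])
    then show "u \<in> constant_directions X" by (intro constant_directionsI) simp
  next
    fix u assume "u \<in> constant_directions X"
    then have "u \<bullet> x = u \<bullet> a" if "x \<in> X" for x
      using that a by (rule constant_directionsD)
    then have "(x - a) \<bullet> u = 0" if "x \<in> X" for x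
      using that by (simp add: inner_diff_right inner_commute[of _ u])
    then show "u \<in> ?O" by (simp add: orthogonal_def)
  qed
  also have "\<dots> = {y \<in> UNIV. \<forall>x\<in>span ?D. orthogonal x y}"
  proof -
    have "orthogonal x u" if "x \<in> span ?D" "u \<in> ?O" for x u
    proof -
      have "orthogonal u x"
        by (rule orthogonal_to_span[OF that(1)]) (use that(2) in \<open>auto simp: orthogonal_commute\<close>)
      then show ?thesis by (simp add: orthogonal_commute)
    qed
    then show ?thesis by (auto simp: span_base)
  qed
  finally have "dim (constant_directions X) + dim ?D = DIM('a)"
    using dim_subspace_orthogonal_to_vectors[of "span ?D" UNIV] by simp
  moreover have "aff_dim X = int (dim ?D)"
    using a by (intro aff_dim_eq_dim) (simp add: hull_inc)
  ultimately show ?thesis by linarith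
qed

lemma minimizers_eq_Int_hyperplane:
  assumes "x \<in> minimizers ((\<bullet>) w) X"
  shows "minimizers ((\<bullet>) w) X = X \<inter> {y. w \<bullet> y = w \<bullet> x}"
  using assms by (auto simp: minimizers_def intro!: antisym)

lemma less_minimizers:
  assumes "x \<in> minimizers f X" "y \<in> X" "y \<notin> minimizers f X"
  shows "f x < f y"
proof -
  obtain z where "z \<in> X" "f z < f y" using assms by (auto simp: minimizers_def not_le)
  then show ?thesis using assms(1) le_less_trans[of "f x" "f z" "f y"] by (simp add: minimizers_def)
qed

lemma minimizers_face_of:
  fixes w :: "'a::euclidean_space"
  assumes "convex X"
  shows "minimizers ((\<bullet>) w) X face_of X"
proof (cases "minimizers ((\<bullet>) w) X = {}")
  case False
  then obtain x where x: "x \<in> minimizers ((\<bullet>) w) X" by blast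
  then have "\<And>y. y \<in> X \<Longrightarrow> w \<bullet> y \<ge> w \<bullet> x" by (simp add: minimizers_def)
  with assms show ?thesis
    unfolding minimizers_eq_Int_hyperplane[OF x] by (rule face_of_Int_supporting_hyperplane_ge)
qed simp

lemma minimizers_constant_directions: "w \<in> constant_directions (minimizers ((\<bullet>) w) X)"
  by (rule constant_directionsI, rule antisym) (auto simp: minimizers_def)

lemma minimizers_eq_iff:
  "minimizers ((\<bullet>) w) X = X \<longleftrightarrow> w \<in> constant_directions X"
proof
  assume "minimizers ((\<bullet>) w) X = X"
  then show "w \<in> constant_directions X" using minimizers_constant_directions[of w X] by simp
next
  assume "w \<in> constant_directions X"
  then have "w \<bullet> x \<le> w \<bullet> y" if "x \<in> X" "y \<in> X" for x y
    using constant_directionsD[OF _ that] by simp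
  then show "minimizers ((\<bullet>) w) X = X" by (auto simp: minimizers_def)
qed

text \<open>The dimension of a set and of its space of constant directions add up to that of the ambient
  space, so dropping one dimension means gaining exactly one constant direction.\<close>

lemma minimizers_facet_of_iff:
  fixes P :: "'a::euclidean_space set"
  assumes "polytope P" "P \<noteq> {}"
  shows "minimizers ((\<bullet>) w) P facet_of P \<longleftrightarrow> w \<notin> constant_directions P \<and>
           constant_directions (minimizers ((\<bullet>) w) P) \<subseteq> span (insert w (constant_directions P))"
proof -
  let ?C = "constant_directions P" and ?F = "minimizers ((\<bullet>) w) P"
  have ne: "?F \<noteq> {}"
    using assms by (simp add: minimizers_nonempty polytope_imp_compact)
  \<comment> \<open>This inclusion holds for every \<open>w\<close>, so the reverse inclusion
    becomes a question of dimension only.\<close>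
  have sub: "span (insert w ?C) \<subseteq> constant_directions ?F"
    by (intro span_minimal subspace_constant_directions)
      (use constant_directions_antimono[OF minimizers_subset] minimizers_constant_directions in auto)
  have "?F facet_of P \<longleftrightarrow> aff_dim ?F = aff_dim P - 1"
    using assms ne by (simp add: facet_of_def minimizers_face_of polytope_imp_convex)
  also have "\<dots> \<longleftrightarrow> dim (constant_directions ?F) = dim ?C + 1"
    using aff_dim_plus_dim_constant_directions[OF ne]
      aff_dim_plus_dim_constant_directions[OF \<open>P \<noteq> {}\<close>] by linarith
  also have "\<dots> \<longleftrightarrow> w \<notin> ?C \<and> constant_directions ?F \<subseteq> span (insert w ?C)"
  proof (cases "w \<in> ?C")
    case True
    then have "?F = P" by (simp add: minimizers_eq_iff)
    with True show ?thesis by simp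
  next
    case False
    then have "dim (span (insert w ?C)) = dim ?C + 1"
      by (simp add: dim_insert)
    with False show ?thesis
      using sub subspace_dim_equal[OF subspace_span subspace_constant_directions sub]
        by (metis order.refl subset_antisym)
  qed
  finally show ?thesis .
qed

lemma facet_of_polytope_minimizers:
  fixes P :: "'a::euclidean_space set"
  assumes "polytope P" "F facet_of P"
  obtains w where "F = minimizers ((\<bullet>) w) P"
proof -
  have F: "F face_of P" "F \<noteq> {}" using assms(2) by (auto simp: facet_of_def)
  with assms(1) have "F exposed_face_of P"
    by (simp add: exposed_face_of_polyhedron polytope_imp_polyhedron)
  then obtain a b where ab: "P \<subseteq> {x. a \<bullet> x \<le> b}" "F = P \<inter> {x. a \<bullet> x = b}"
    by (auto simp: exposed_face_of_def)
  obtain x where "x \<in> F" using F by blast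
  \<comment> \<open>The exposing functional \<open>a\<close> is maximal on the face, hence the
    sign.\<close>
  then have "x \<in> minimizers ((\<bullet>) (- a)) P" "a \<bullet> x = b"
    using ab by (auto simp: minimizers_def)
  then have "F = minimizers ((\<bullet>) (- a)) P"
    using ab(2) minimizers_eq_Int_hyperplane[of x "- a" P] by simp
  then show ?thesis using that by blast
qed

text \<open>Functionals constant on a facet are spanned by its normal and the functionals constant
  on \<open>P\<close>, so two normals of one facet are proportional modulo the latter. A point of
  \<open>P\<close> off the facet fixes the sign of the factor.\<close>

lemma facet_minimizers_eq_iff:
  fixes P :: "'a::euclidean_space set"
  assumes "polytope P" "P \<noteq> {}" "minimizers ((\<bullet>) w) P facet_of P" "minimizers ((\<bullet>) w') P facet_of P"
  shows "minimizers ((\<bullet>) w) P = minimizers ((\<bullet>) w') P \<longleftrightarrow> (\<exists>\<alpha>>0. w' - \<alpha> *\<^sub>R w \<in> constant_directions P)"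
proof
  assume eq: "minimizers ((\<bullet>) w) P = minimizers ((\<bullet>) w') P"
  have "w' \<in> constant_directions (minimizers ((\<bullet>) w) P)"
    by (simp add: eq minimizers_constant_directions)
  then have "w' \<in> span (insert w (constant_directions P))"
    using assms minimizers_facet_of_iff by blast
  then obtain \<alpha> where \<alpha>: "w' - \<alpha> *\<^sub>R w \<in> constant_directions P"
    by (auto simp: span_insert)
  have ne: "minimizers ((\<bullet>) w) P \<noteq> {}" and proper: "minimizers ((\<bullet>) w) P \<noteq> P"
    using assms(3) by (auto simp: facet_of_def)
  obtain x where x: "x \<in> minimizers ((\<bullet>) w) P" using ne by blast
  obtain y where y: "y \<in> P" "y \<notin> minimizers ((\<bullet>) w) P" using proper minimizers_subset[of "(\<bullet>) w" P] by blast
  have "w \<bullet> x < w \<bullet> y" "w' \<bullet> x < w' \<bullet> y"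
    using x y eq by (auto intro: less_minimizers)
  moreover have "w' \<bullet> y - w' \<bullet> x = \<alpha> * (w \<bullet> y - w \<bullet> x)"
  proof -
    have "(w' - \<alpha> *\<^sub>R w) \<bullet> x = (w' - \<alpha> *\<^sub>R w) \<bullet> y"
      using x y(1) by (intro constant_directionsD[OF \<alpha>]) (auto simp: minimizers_def)
    then show ?thesis by (simp add: inner_diff_left right_diff_distrib)
  qed
  ultimately have "\<alpha> > 0"
    by (metis diff_gt_0_iff_gt zero_less_mult_pos2)
  with \<alpha> show "\<exists>\<alpha>>0. w' - \<alpha> *\<^sub>R w \<in> constant_directions P" by blast
next
  assume "\<exists>\<alpha>>0. w' - \<alpha> *\<^sub>R w \<in> constant_directions P"
  then obtain \<alpha> where \<alpha>: "\<alpha> > 0" "w' - \<alpha> *\<^sub>R w \<in> constant_directions P" by blast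
  have "w' \<bullet> x \<le> w' \<bullet> y \<longleftrightarrow> w \<bullet> x \<le> w \<bullet> y" if "x \<in> P" "y \<in> P" for x y
  proof -
    have "(w' - \<alpha> *\<^sub>R w) \<bullet> x = (w' - \<alpha> *\<^sub>R w) \<bullet> y"
      by (rule constant_directionsD[OF \<alpha>(2) that])
    then have "w' \<bullet> y - w' \<bullet> x = \<alpha> * (w \<bullet> y - w \<bullet> x)"
      by (simp add: inner_diff_left right_diff_distrib)
    then show ?thesis using \<alpha>(1)
      by (metis diff_ge_0_iff_ge zero_le_mult_iff less_le_not_le)
  qed
  then show "minimizers ((\<bullet>) w) P = minimizers ((\<bullet>) w') P"
    by (auto simp: minimizers_def)
qed

section \<open>Minimizing faces and constant directions of Minkowski sums and convex hulls\<close>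

lemma minimizers_set_plus:
  "minimizers ((\<bullet>) w) (A + B) = minimizers ((\<bullet>) w) A + minimizers ((\<bullet>) w) B"
proof (intro equalityI subsetI)
  fix x assume x: "x \<in> minimizers ((\<bullet>) w) (A + B)"
  then obtain a b where ab: "a \<in> A" "b \<in> B" "x = a + b"
    by (auto simp: minimizers_def elim: set_plus_elim)
  have min: "w \<bullet> (a + b) \<le> w \<bullet> (a' + b')" if "a' \<in> A" "b' \<in> B" for a' b'
    using x ab that by (auto simp: minimizers_def)
  have "a \<in> minimizers ((\<bullet>) w) A" "b \<in> minimizers ((\<bullet>) w) B"
    using ab min[OF _ ab(2)] min[OF ab(1)] by (auto simp: minimizers_def inner_add_right)
  then show "x \<in> minimizers ((\<bullet>) w) A + minimizers ((\<bullet>) w) B" using ab by blast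
next
  fix x assume "x \<in> minimizers ((\<bullet>) w) A + minimizers ((\<bullet>) w) B"
  then show "x \<in> minimizers ((\<bullet>) w) (A + B)"
    by (auto simp: minimizers_def inner_add_right set_plus_def intro!: add_mono)
qed

lemma minimizers_sum:
  assumes "finite I"
  shows "minimizers ((\<bullet>) w) (\<Sum>i\<in>I. X i) = (\<Sum>i\<in>I. minimizers ((\<bullet>) w) (X i))"
  using assms
proof (induction I)
  case empty
  show ?case by (auto simp: minimizers_def set_zero)
qed (simp add: minimizers_set_plus)

lemma set_sum_nonempty:
  fixes X :: "'i \<Rightarrow> 'a::comm_monoid_add set"
  assumes "finite I" "\<And>i. i \<in> I \<Longrightarrow> X i \<noteq> {}"
  shows "(\<Sum>i\<in>I. X i) \<noteq> {}"
  using assms by (induction I) (auto simp: set_zero set_plus_def)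

text \<open>One summand is held at a fixed point while the other varies. Nonemptiness supplies that
  point: an empty summand would empty the sum and make every direction constant.\<close>

lemma constant_directions_set_plus:
  assumes "A \<noteq> {}" "B \<noteq> {}"
  shows "constant_directions (A + B) = constant_directions A \<inter> constant_directions B"
proof (intro equalityI subsetI)
  fix u assume u: "u \<in> constant_directions (A + B)"
  obtain a b where ab: "a \<in> A" "b \<in> B" using assms by blast
  have *: "u \<bullet> (a' + b') = u \<bullet> (a'' + b'')" if "a' \<in> A" "b' \<in> B" "a'' \<in> A" "b'' \<in> B" for a' b' a'' b''
    using that by (intro constant_directionsD[OF u] set_plus_intro)
  have "u \<bullet> a' = u \<bullet> a''" if "a' \<in> A" "a'' \<in> A" for a' a''
    using *[OF that(1) ab(2) that(2) ab(2)] by (simp add: inner_add_right)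
  moreover have "u \<bullet> b' = u \<bullet> b''" if "b' \<in> B" "b'' \<in> B" for b' b''
    using *[OF ab(1) that(1) ab(1) that(2)] by (simp add: inner_add_right)
  ultimately show "u \<in> constant_directions A \<inter> constant_directions B"
    by (blast intro: constant_directionsI)
next
  fix u assume u: "u \<in> constant_directions A \<inter> constant_directions B"
  show "u \<in> constant_directions (A + B)"
  proof (rule constant_directionsI)
    fix x y assume "x \<in> A + B" "y \<in> A + B"
    then obtain a b a' b' where "x = a + b" "y = a' + b'" "a \<in> A" "a' \<in> A" "b \<in> B" "b' \<in> B"
      by (elim set_plus_elim)
    with u show "u \<bullet> x = u \<bullet> y"
      using constant_directionsD[of u A a a'] constant_directionsD[of u B b b']
      by (simp add: inner_add_right)
  qed
qed

lemma constant_directions_sum: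
  assumes "finite I" "\<And>i. i \<in> I \<Longrightarrow> X i \<noteq> {}"
  shows "constant_directions (\<Sum>i\<in>I. X i) = (\<Inter>i\<in>I. constant_directions (X i))"
  using assms
proof (induction I)
  case empty
  show ?case by (simp add: constant_directions_def set_zero)
next
  case (insert i I)
  then show ?case
    by (simp add: constant_directions_set_plus set_sum_nonempty)
qed

lemma constant_directions_convex_hull:
  "constant_directions (convex hull V) = constant_directions V"
proof (intro equalityI subsetI)
  fix u assume "u \<in> constant_directions (convex hull V)"
  then show "u \<in> constant_directions V"
    using constant_directions_antimono[OF hull_subset] by blast
next
  fix u assume u: "u \<in> constant_directions V"
  show "u \<in> constant_directions (convex hull V)"
  proof (cases "V = {}")
    case False
    then obtain v where v: "v \<in> V" by blast
    have "V \<subseteq> {x. u \<bullet> x = u \<bullet> v}" using constant_directionsD[OF u _ v] by blast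
    then have "convex hull V \<subseteq> {x. u \<bullet> x = u \<bullet> v}"
      by (simp add: hull_minimal convex_hyperplane)
    then have "u \<bullet> x = u \<bullet> v" if "x \<in> convex hull V" for x using that by blast
    then show ?thesis by (intro constant_directionsI) simp
  qed (simp add: constant_directions_def)
qed

text \<open>A face of the hull of a compact set is the hull of some of the generators, and these are
  then minimizers in \<open>V\<close>. Conversely, a lower bound for \<open>w\<close> on
  \<open>V\<close> defines a halfspace, which being convex contains the whole hull.\<close>

lemma minimizers_convex_hull:
  fixes V :: "'a::euclidean_space set"
  assumes "compact V"
  shows "minimizers ((\<bullet>) w) (convex hull V) = convex hull (minimizers ((\<bullet>) w) V)"
proof
  obtain S where S: "S \<subseteq> V" "minimizers ((\<bullet>) w) (convex hull V) = convex hull S"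
    using face_of_convex_hull_subset[OF assms minimizers_face_of[OF convex_convex_hull]] by metis
  then have "S \<subseteq> minimizers ((\<bullet>) w) (convex hull V) \<inter> V" by (simp add: hull_subset)
  also have "\<dots> \<subseteq> minimizers ((\<bullet>) w) V"
    by (auto simp: minimizers_def hull_inc)
  finally show "minimizers ((\<bullet>) w) (convex hull V) \<subseteq> convex hull (minimizers ((\<bullet>) w) V)"
    unfolding S(2) by (rule hull_mono)
next
  have "x \<in> minimizers ((\<bullet>) w) (convex hull V)" if x: "x \<in> minimizers ((\<bullet>) w) V" for x
  proof -
    have "convex hull V \<subseteq> {y. w \<bullet> y \<ge> w \<bullet> x}"
      using x by (intro hull_minimal convex_halfspace_ge) (auto simp: minimizers_def)
    with x show ?thesis by (auto simp: minimizers_def hull_inc)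
  qed
  then show "convex hull (minimizers ((\<bullet>) w) V) \<subseteq> minimizers ((\<bullet>) w) (convex hull V)"
    by (intro hull_minimal face_of_imp_convex[OF minimizers_face_of[OF convex_convex_hull]]) auto
qed

lemma constant_directions_minimizers_sum_convex_hull:
  fixes V :: "'i \<Rightarrow> 'a::euclidean_space set"
  assumes "finite I" "\<And>i. i \<in> I \<Longrightarrow> finite (V i)" "\<And>i. i \<in> I \<Longrightarrow> V i \<noteq> {}"
  shows "constant_directions (minimizers ((\<bullet>) w) (\<Sum>i\<in>I. convex hull V i)) =
           (\<Inter>i\<in>I. constant_directions (minimizers ((\<bullet>) w) (V i)))"
proof -
  have "constant_directions (minimizers ((\<bullet>) w) (\<Sum>i\<in>I. convex hull V i)) =
          constant_directions (\<Sum>i\<in>I. convex hull (minimizers ((\<bullet>) w) (V i)))"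
    using assms by (simp add: minimizers_sum minimizers_convex_hull finite_imp_compact)
  also have "\<dots> = (\<Inter>i\<in>I. constant_directions (minimizers ((\<bullet>) w) (V i)))"
    using assms by (subst constant_directions_sum)
      (auto simp: constant_directions_convex_hull minimizers_nonempty finite_imp_compact)
  finally show ?thesis .
qed

lemma polytope_sum_convex_hull:
  fixes V :: "'i \<Rightarrow> 'a::euclidean_space set"
  assumes "finite I" "\<And>i. i \<in> I \<Longrightarrow> finite (V i)"
  shows "polytope (\<Sum>i\<in>I. convex hull V i)"
proof -
  have "finite (\<Sum>i\<in>I. V i)"
    using assms by (induction I) (auto simp: set_zero finite_set_plus)
  then show ?thesis
    by (simp add: convex_hull_set_sum[symmetric] polytope_convex_hull)
qed

section \<open>Facet weights\<close>

text \<open>The criterion \<open>minimizers_facet_of_iff\<close> in coordinates: the first conjunct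
  says that the functional is not constant on the polytope, the second is the inclusion into the
  span, called rigidity below.\<close>

definition facet_weight :: "nat \<Rightarrow> nat \<Rightarrow> nat \<Rightarrow> (nat \<Rightarrow> real) \<Rightarrow> bool" where
  "facet_weight n k s f \<longleftrightarrow>
     (\<exists>i<n. \<not> f constant_on lam k s i) \<and>
     (\<forall>g. (\<forall>i<n. g constant_on minimizers f (lam k s i)) \<longrightarrow>
        (\<exists>\<alpha>. \<forall>i<n. (\<lambda>x. g x - \<alpha> * f x) constant_on lam k s i))"

lemma constant_onI: "(\<And>x y. x \<in> A \<Longrightarrow> y \<in> A \<Longrightarrow> f x = f y) \<Longrightarrow> f constant_on A"
  unfolding constant_on_def by metis

lemma constant_onD: "f constant_on A \<Longrightarrow> x \<in> A \<Longrightarrow> y \<in> A \<Longrightarrow> f x = f y"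
  by (auto simp: constant_on_def)

lemma constant_on_cong: "(\<And>x. x \<in> A \<Longrightarrow> f x = g x) \<Longrightarrow> f constant_on A \<longleftrightarrow> g constant_on A"
  by (simp add: constant_on_def)

lemma inner_std_basis: "w \<bullet> std_basis v j = w $ v j"
  by (simp add: std_basis_def inner_axis)

lemma constant_directions_std_basis:
  "w \<in> constant_directions (std_basis v ` L) \<longleftrightarrow> (\<lambda>j. w $ v j) constant_on L"
proof
  assume w: "w \<in> constant_directions (std_basis v ` L)"
  have "w $ v x = w $ v y" if "x \<in> L" "y \<in> L" for x y
    using constant_directionsD[OF w that[THEN imageI]] unfolding inner_std_basis .
  then show "(\<lambda>j. w $ v j) constant_on L"
    by (rule constant_onI)
next
  assume "(\<lambda>j. w $ v j) constant_on L"
  then show "w \<in> constant_directions (std_basis v ` L)"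
    by (intro constant_directionsI) (auto simp: inner_std_basis dest: constant_onD)
qed

lemma minimizers_std_basis:
  "minimizers ((\<bullet>) w) (std_basis v ` L) = std_basis v ` minimizers (\<lambda>j. w $ v j) L"
  by (auto simp: minimizers_def inner_std_basis)

lemma lam_subset: "i < n \<Longrightarrow> lam k s i \<subseteq> {..<s * (n - 1) + k}"
proof -
  assume "i < n"
  then have "s * i \<le> s * (n - 1)" by (intro mult_le_mono2) simp
  then have "x < s * (n - 1) + k" if "x < s * i + k" for x using that by linarith
  then show ?thesis unfolding lam_def by auto
qed

lemma facet_weight_cong:
  assumes "\<And>j. j < s * (n - 1) + k \<Longrightarrow> f j = f' j"
  shows "facet_weight n k s f \<longleftrightarrow> facet_weight n k s f'"
proof -
  have eq: "f j = f' j" if "i < n" "j \<in> lam k s i" for i j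
    using assms lam_subset[OF that(1)] that(2) by blast
  have "f constant_on lam k s i \<longleftrightarrow> f' constant_on lam k s i"
    "minimizers f (lam k s i) = minimizers f' (lam k s i)"
    "(\<lambda>x. g x - \<alpha> * f x) constant_on lam k s i \<longleftrightarrow> (\<lambda>x. g x - \<alpha> * f' x) constant_on lam k s i"
    if "i < n" for i g \<alpha>
    using eq[OF that] by (auto simp: minimizers_def cong: constant_on_cong)
  then show ?thesis unfolding facet_weight_def by (simp cong: conj_cong)
qed

section \<open>From facets of the polytope to facet weights\<close>

context
  fixes n k s :: nat and v :: "nat \<Rightarrow> 'm::finite"
  assumes k: "k > 0" and bij: "bij_betw v {..<s * (n - 1) + k} (UNIV :: 'm set)"
begin

lemma polytope_P_poly: "polytope (P_poly v n k s)"
  unfolding P_poly_def coord_simplex_def by (intro polytope_sum_convex_hull) (auto simp: lam_def)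

lemma P_poly_nonempty: "P_poly v n k s \<noteq> {}"
  unfolding P_poly_def coord_simplex_def using k by (intro set_sum_nonempty) (auto simp: lam_def)

lemma constant_directions_P_poly:
  "w \<in> constant_directions (P_poly v n k s) \<longleftrightarrow> (\<forall>i<n. (\<lambda>j. w $ v j) constant_on lam k s i)"
  unfolding P_poly_def coord_simplex_def using k
  by (subst constant_directions_sum)
    (auto simp: lam_def constant_directions_convex_hull constant_directions_std_basis)

lemma constant_directions_face_P_poly:
  "u \<in> constant_directions (minimizers ((\<bullet>) w) (P_poly v n k s)) \<longleftrightarrow>
     (\<forall>i<n. (\<lambda>j. u $ v j) constant_on minimizers (\<lambda>j. w $ v j) (lam k s i))"
  unfolding P_poly_def coord_simplex_def using k
  by (subst constant_directions_minimizers_sum_convex_hull)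
    (auto simp: lam_def minimizers_std_basis constant_directions_std_basis)

lemma weight_vector_exists: "\<exists>w :: real ^ 'm. \<forall>j<s * (n - 1) + k. w $ v j = f j"
proof
  show "\<forall>j<s * (n - 1) + k. (\<chi> a. f (inv_into {..<s * (n - 1) + k} v a)) $ v j = f j"
    using bij by (auto simp: bij_betw_def inv_into_f_f)
qed

lemma facet_of_P_poly_iff:
  "minimizers ((\<bullet>) w) (P_poly v n k s) facet_of P_poly v n k s \<longleftrightarrow>
     facet_weight n k s (\<lambda>j. w $ v j)"
proof -
  let ?P = "P_poly v n k s"
  have span: "u \<in> span (insert w (constant_directions ?P)) \<longleftrightarrow>
      (\<exists>\<alpha>. \<forall>i<n. (\<lambda>j. u $ v j - \<alpha> * w $ v j) constant_on lam k s i)" for u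
    by (simp add: span_insert constant_directions_P_poly)
  \<comment> \<open>The facet criterion quantifies over vectors, \<open>facet_weight\<close> over
    functions on all naturals. Both depend only on the indices below K, where every function comes
    from a vector.\<close>
  have vec: "(\<forall>u. (\<forall>i<n. (\<lambda>j. u $ v j) constant_on minimizers (\<lambda>j. w $ v j) (lam k s i)) \<longrightarrow>
        (\<exists>\<alpha>. \<forall>i<n. (\<lambda>j. u $ v j - \<alpha> * w $ v j) constant_on lam k s i)) \<longleftrightarrow>
      (\<forall>g :: nat \<Rightarrow> real. (\<forall>i<n. g constant_on minimizers (\<lambda>j. w $ v j) (lam k s i)) \<longrightarrow>
        (\<exists>\<alpha>. \<forall>i<n. (\<lambda>j. g j - \<alpha> * w $ v j) constant_on lam k s i))" (is "?L \<longleftrightarrow> ?R")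
  proof
    assume L: ?L
    show ?R
    proof (intro allI impI)
      fix g :: "nat \<Rightarrow> real" assume g: "\<forall>i<n. g constant_on minimizers (\<lambda>j. w $ v j) (lam k s i)"
      obtain u where u: "\<And>j. j < s * (n - 1) + k \<Longrightarrow> u $ v j = g j"
        using weight_vector_exists by blast
      have eq: "u $ v j = g j" if "i < n" "j \<in> lam k s i" for i j
        using u lam_subset[OF that(1)] that(2) by blast
      have "\<forall>i<n. (\<lambda>j. u $ v j) constant_on minimizers (\<lambda>j. w $ v j) (lam k s i)"
      proof (intro allI impI)
        fix i assume "i < n"
        then have "u $ v j = g j" if "j \<in> minimizers (\<lambda>j. w $ v j) (lam k s i)" for j
          using eq that by (simp add: minimizers_def)
        then show "(\<lambda>j. u $ v j) constant_on minimizers (\<lambda>j. w $ v j) (lam k s i)"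
          using g \<open>i < n\<close> by (simp cong: constant_on_cong)
      qed
      then obtain \<alpha> where "\<forall>i<n. (\<lambda>j. u $ v j - \<alpha> * w $ v j) constant_on lam k s i"
        using L by blast
      then show "\<exists>\<alpha>. \<forall>i<n. (\<lambda>j. g j - \<alpha> * w $ v j) constant_on lam k s i"
        using eq by (intro exI[of _ \<alpha>]) (simp cong: constant_on_cong)
    qed
  next
    assume R: ?R
    show ?L
    proof (intro allI impI)
      fix u :: "real ^ 'm"
      assume "\<forall>i<n. (\<lambda>j. u $ v j) constant_on minimizers (\<lambda>j. w $ v j) (lam k s i)"
      then show "\<exists>\<alpha>. \<forall>i<n. (\<lambda>j. u $ v j - \<alpha> * w $ v j) constant_on lam k s i"
        by (rule R[THEN spec, THEN mp])
    qed
  qed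
  show ?thesis
    unfolding minimizers_facet_of_iff[OF polytope_P_poly P_poly_nonempty] facet_weight_def vec[symmetric]
    by (auto simp: subset_iff span constant_directions_P_poly constant_directions_face_P_poly)
qed

text \<open>The counting principle for both cases: \<open>r\<close> lists representatives of the
  facet weights modulo positive scaling and weights constant on every \<open>lam k s i\<close>.
  Sending \<open>j\<close> to the face minimizing \<open>r j\<close> is then a bijection from
  \<open>J\<close> onto the facets.\<close>

lemma card_facets_P_poly:
  fixes r :: "'j \<Rightarrow> nat \<Rightarrow> real"
  assumes facet: "\<And>j. j \<in> J \<Longrightarrow> facet_weight n k s (r j)"
    and complete: "\<And>f. facet_weight n k s f \<Longrightarrow>
      \<exists>j\<in>J. \<exists>\<alpha>>0. \<forall>i<n. (\<lambda>x. f x - \<alpha> * r j x) constant_on lam k s i"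
    and distinct: "\<And>j j' \<alpha>. j \<in> J \<Longrightarrow> j' \<in> J \<Longrightarrow> \<alpha> > 0 \<Longrightarrow>
      \<forall>i<n. (\<lambda>x. r j x - \<alpha> * r j' x) constant_on lam k s i \<Longrightarrow> j = j'"
  shows "card {F. F facet_of P_poly v n k s} = card J"
proof -
  let ?P = "P_poly v n k s"
  obtain w where w: "\<And>j x. x < s * (n - 1) + k \<Longrightarrow> w j $ v x = r j x"
    using choice[OF allI[OF weight_vector_exists]] by blast
  define F where "F j = minimizers ((\<bullet>) (w j)) ?P" for j
  have wr: "w j $ v x = r j x" if "i < n" "x \<in> lam k s i" for i x j
    using w lam_subset[OF that(1)] that(2) by blast
  have F: "F j facet_of ?P" if "j \<in> J" for j
    using facet[OF that] facet_weight_cong[of s n k "\<lambda>x. w j $ v x" "r j"] w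
    unfolding F_def facet_of_P_poly_iff by blast
  have F_eq: "minimizers ((\<bullet>) u) ?P = F j \<longleftrightarrow>
      (\<exists>\<alpha>>0. \<forall>i<n. (\<lambda>x. u $ v x - \<alpha> * r j x) constant_on lam k s i)"
    if "minimizers ((\<bullet>) u) ?P facet_of ?P" "j \<in> J" for u j
  proof -
    have "minimizers ((\<bullet>) u) ?P = F j \<longleftrightarrow> (\<exists>\<alpha>>0. u - \<alpha> *\<^sub>R w j \<in> constant_directions ?P)"
      using facet_minimizers_eq_iff[OF polytope_P_poly P_poly_nonempty F[OF that(2), unfolded F_def] that(1)]
      by (auto simp: F_def)
    also have "\<dots> \<longleftrightarrow> (\<exists>\<alpha>>0. \<forall>i<n. (\<lambda>x. u $ v x - \<alpha> * r j x) constant_on lam k s i)"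
      by (simp add: constant_directions_P_poly wr cong: constant_on_cong conj_cong)
    finally show ?thesis .
  qed
  have "inj_on F J"
  proof
    fix j j' assume j: "j \<in> J" "j' \<in> J" "F j = F j'"
    then obtain \<alpha> where "\<alpha> > 0" "\<forall>i<n. (\<lambda>x. w j $ v x - \<alpha> * r j' x) constant_on lam k s i"
      using F_eq[of "w j" j'] F by (auto simp: F_def)
    then have "\<forall>i<n. (\<lambda>x. r j x - \<alpha> * r j' x) constant_on lam k s i"
      by (simp add: wr cong: constant_on_cong)
    with j \<open>\<alpha> > 0\<close> show "j = j'" using distinct by blast
  qed
  moreover have "F ` J = {F. F facet_of ?P}"
  proof (intro equalityI subsetI)
    fix G assume "G \<in> {F. F facet_of ?P}"
    then have G: "G facet_of ?P" by simp
    then obtain u where u: "G = minimizers ((\<bullet>) u) ?P"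
      using facet_of_polytope_minimizers[OF polytope_P_poly] by blast
    then obtain j where "j \<in> J" "G = F j"
      using complete[of "\<lambda>j. u $ v j"] G F_eq[of u] by (auto simp: facet_of_P_poly_iff)
    then show "G \<in> F ` J" by blast
  qed (use F in auto)
  ultimately show ?thesis using card_image by metis
qed

end

lemma minimizers_constant:
  assumes "\<And>x. x \<in> X \<Longrightarrow> f x = c"
  shows "minimizers f X = X"
  using assms by (auto simp: minimizers_def)

lemma mem_lam_iff: "x \<in> lam k s i \<longleftrightarrow> s * i \<le> x \<and> x < s * i + k"
  by (simp add: lam_def)

text \<open>Rigidity of \<open>f\<close> expresses a representative \<open>r\<close> through
  \<open>f\<close>, whereas completeness of a list of representatives needs \<open>f\<close>
  expressed through \<open>r\<close>.\<close>

lemma scaled_constant_on: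
  fixes f r :: "'a \<Rightarrow> real"
  assumes "(\<lambda>x. r x - \<alpha> * f x) constant_on A" "\<alpha> \<noteq> 0"
  shows "(\<lambda>x. f x - 1 / \<alpha> * r x) constant_on A"
proof -
  obtain c where c: "\<And>x. x \<in> A \<Longrightarrow> r x - \<alpha> * f x = c"
    using assms(1) by (auto simp: constant_on_def)
  have "f x - 1 / \<alpha> * r x = - c / \<alpha>" if "x \<in> A" for x
    using c[OF that] assms(2) by (simp add: field_simps)
  then show ?thesis by (auto simp: constant_on_def)
qed

section \<open>The case \<open>k \<le> s + 1\<close>\<close>

text \<open>For the end points of \<open>\<lambda>\<^sub>i\<close> a plain indicator of the point would fail to be constant on the
  neighbouring \<open>\<lambda>\<close> when \<open>k = s + 1\<close>; extending it by 1 to that side repairs this.\<close>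

definition vertex_weight :: "nat \<Rightarrow> nat \<Rightarrow> nat \<times> nat \<Rightarrow> nat \<Rightarrow> real" where
  "vertex_weight k s = (\<lambda>(i, t) x.
     of_bool (if t = 0 then x \<le> s * i else if t = k - 1 then s * i + t \<le> x else x = s * i + t))"

lemma vertex_weight_same:
  assumes "t < k" "x \<in> lam k s i"
  shows "vertex_weight k s (i, t) x = of_bool (x = s * i + t)"
  using assms by (auto simp: vertex_weight_def mem_lam_iff)

text \<open>Since \<open>k \<le> s + 1\<close>, an earlier \<open>lam k s i'\<close> lies at or
  below the first index of \<open>lam k s i\<close>, and a later one at or above the last. There the
  weight is constantly 1 if \<open>t\<close> marks the end on that side, and constantly 0
  otherwise.\<close>

lemma vertex_weight_other:
  assumes "1 < k" "k \<le> s + 1" "t < k" "i' \<noteq> i"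
  shows "vertex_weight k s (i, t) constant_on lam k s i'"
proof (cases "i' < i")
  case True
  then have "s * Suc i' \<le> s * i" by (intro mult_le_mono2) simp
  then have "x \<le> s * i" if "x \<in> lam k s i'" for x using that assms by (simp add: mem_lam_iff)
  then have "vertex_weight k s (i, t) x = of_bool (t = 0)" if "x \<in> lam k s i'" for x
    using that assms by (fastforce simp: vertex_weight_def)
  then show ?thesis unfolding constant_on_def by blast
next
  case False
  with assms have "s * Suc i \<le> s * i'" by (intro mult_le_mono2) simp
  then have "s * i + s \<le> x" if "x \<in> lam k s i'" for x using that by (simp add: mem_lam_iff)
  then have "vertex_weight k s (i, t) x = of_bool (t = k - 1)" if "x \<in> lam k s i'" for x
    using that assms by (fastforce simp: vertex_weight_def)
  then show ?thesis unfolding constant_on_def by blast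
qed

lemma facet_weight_vertex_weight:
  assumes "1 < k" "k \<le> s + 1" "t < k" "i < n"
  shows "facet_weight n k s (vertex_weight k s (i, t))"
proof -
  let ?r = "vertex_weight k s (i, t)" and ?j = "s * i + t"
  have j: "?j \<in> lam k s i" using assms by (simp add: mem_lam_iff)
  \<comment> \<open>A minimizing index of \<open>lam k s i\<close>; it exists because
    \<open>k > 1\<close>.\<close>
  obtain z where z: "z \<in> lam k s i" "z \<noteq> ?j"
  proof
    let ?z = "if t = 0 then s * i + 1 else s * i"
    show "?z \<in> lam k s i" "?z \<noteq> ?j" using assms by (auto simp: mem_lam_iff)
  qed
  note same = vertex_weight_same[OF \<open>t < k\<close>]
  have "\<not> ?r constant_on lam k s i"
    using constant_onD[of ?r "lam k s i" ?j z] j z by (auto simp: same)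
  moreover have "\<exists>\<alpha>. \<forall>i'<n. (\<lambda>x. g x - \<alpha> * ?r x) constant_on lam k s i'"
    if g: "\<forall>i'<n. g constant_on minimizers ?r (lam k s i')" for g
  proof (intro exI allI impI)
    fix i' assume "i' < n"
    \<comment> \<open>The factor is the jump of \<open>g\<close> at \<open>?j\<close>: away from
      \<open>?j\<close>, \<open>g\<close> takes the single value \<open>g z\<close> on
      \<open>lam k s i\<close>.\<close>
    show "(\<lambda>x. g x - (g ?j - g z) * ?r x) constant_on lam k s i'"
    proof (cases "i' = i")
      case True
      have "lam k s i - {?j} \<subseteq> minimizers ?r (lam k s i)"
        by (auto simp: minimizers_def same)
      then have "g x = g z" if "x \<in> lam k s i" "x \<noteq> ?j" for x
        using constant_onD[of g "minimizers ?r (lam k s i)" x z] g \<open>i < n\<close> that z by blast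
      then have "g x - (g ?j - g z) * ?r x = g z" if "x \<in> lam k s i" for x
        using that by (cases "x = ?j") (simp_all add: same)
      then show ?thesis unfolding True constant_on_def by blast
    next
      case False
      obtain c where c: "\<forall>x\<in>lam k s i'. ?r x = c"
        using vertex_weight_other[OF assms(1-3) False] unfolding constant_on_def ..
      then have "minimizers ?r (lam k s i') = lam k s i'"
        by (intro minimizers_constant) blast
      then have "g constant_on lam k s i'"
        using g[rule_format, OF \<open>i' < n\<close>] by simp
      then show ?thesis using c by (auto simp: constant_on_def)
    qed
  qed
  ultimately show ?thesis using \<open>i < n\<close> unfolding facet_weight_def by blast
qed

text \<open>Take an index \<open>j\<close> at which \<open>f\<close> is not minimal on some
  \<open>lam k s i\<close>. The vertex weight of \<open>j\<close> vanishes on the minimizers in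
  \<open>lam k s i\<close> and is constant on every other \<open>lam\<close>, so rigidity makes it a
  multiple of \<open>f\<close> up to constants.\<close>

lemma facet_weight_vertex_weight_complete:
  assumes k: "1 < k" "k \<le> s + 1" and f: "facet_weight n k s f"
  shows "\<exists>p \<in> {..<n} \<times> {..<k}. \<exists>\<alpha>>0.
    \<forall>i<n. (\<lambda>x. f x - \<alpha> * vertex_weight k s p x) constant_on lam k s i"
proof -
  obtain i where i: "i < n" "\<not> f constant_on lam k s i"
    using f by (auto simp: facet_weight_def)
  then obtain j y where jy: "j \<in> lam k s i" "y \<in> lam k s i" "f y < f j"
    by (metis constant_onI linorder_neqE_linordered_idom)
  define t where "t = j - s * i"
  have t: "t < k" "j = s * i + t" using jy(1) by (auto simp: mem_lam_iff t_def)
  let ?r = "vertex_weight k s (i, t)"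
  have "?r constant_on minimizers f (lam k s i')" for i'
  proof (cases "i' = i")
    case True
    have "?r x = 0" if "x \<in> minimizers f (lam k s i)" for x
      using that jy t vertex_weight_same[OF t(1), of x s i] by (auto simp: minimizers_def)
    then show ?thesis unfolding True constant_on_def by blast
  next
    case False
    show ?thesis
      by (rule constant_on_subset[OF vertex_weight_other[OF k t(1) False] minimizers_subset])
  qed
  then obtain \<alpha> where \<alpha>: "\<forall>i'<n. (\<lambda>x. ?r x - \<alpha> * f x) constant_on lam k s i'"
    using f unfolding facet_weight_def by blast
  have "?r j - \<alpha> * f j = ?r y - \<alpha> * f y"
    using constant_onD[OF \<alpha>[rule_format, OF i(1)] jy(1,2)] .
  moreover have "?r j = 1" "?r y = 0" using jy t vertex_weight_same[OF t(1), of _ s i] by auto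
  \<comment> \<open>Comparing \<open>j\<close> with the smaller value at \<open>y\<close> shows that
    the factor is positive.\<close>
  ultimately have "\<alpha> * (f j - f y) = 1" by (simp add: right_diff_distrib)
  with jy(3) have "\<alpha> > 0" by (metis diff_gt_0_iff_gt zero_less_mult_pos2 zero_less_one)
  then show ?thesis
    using \<alpha> i(1) t(1) scaled_constant_on[of ?r \<alpha> f]
    by (intro bexI[of _ "(i, t)"] exI[of _ "1 / \<alpha>"]) auto
qed

text \<open>On \<open>lam k s i\<close> the first weight is the indicator of one point, the second
  that of another point or a constant. In the former case equivalence would force \<alpha> = -1,
  which does occur for \<open>k = 2\<close>, so positivity of the factor matters.\<close>

lemma vertex_weight_distinct:
  assumes k: "1 < k" "k \<le> s + 1" and it: "i < n" "t < k" "t' < k" and "\<alpha> > 0"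
    and const: "(\<lambda>x. vertex_weight k s (i, t) x - \<alpha> * vertex_weight k s (i', t') x) constant_on lam k s i"
  shows "(i, t) = (i', t')"
proof (rule ccontr)
  assume neq: "(i, t) \<noteq> (i', t')"
  note D = constant_onD[OF const]
  have lam: "s * i + u \<in> lam k s i" if "u < k" for u using that by (simp add: mem_lam_iff)
  show False
  proof (cases "i' = i")
    case True
    with neq have "t \<noteq> t'" by simp
    then show False
      using D[OF lam[OF it(2)] lam[OF it(3)]] lam it True \<open>\<alpha> > 0\<close> by (simp add: vertex_weight_same)
  next
    case False
    then have "i \<noteq> i'" by simp
    from vertex_weight_other[OF k it(3) this]
    obtain c where c: "\<forall>x\<in>lam k s i. vertex_weight k s (i', t') x = c"
      unfolding constant_on_def ..
    obtain u where u: "u < k" "u \<noteq> t" using k by (metis less_trans zero_less_one zero_neq_one)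
    show False
      using D[OF lam[OF it(2)] lam[OF u(1)]] lam it u by (simp add: vertex_weight_same c)
  qed
qed

section \<open>The case \<open>k > s + 1\<close>\<close>

lemma constant_on_Un:
  assumes "g constant_on A" "g constant_on B" "A \<inter> B \<noteq> {}"
  shows "g constant_on A \<union> B"
proof -
  obtain p where "p \<in> A" "p \<in> B" using assms(3) by blast
  then have "g x = g p" if "x \<in> A \<union> B" for x
    using that constant_onD[OF assms(1), of x p] constant_onD[OF assms(2), of x p] by blast
  then show ?thesis unfolding constant_on_def by blast
qed

text \<open>Constancy propagates along a chain of sets in which neighbours overlap. All rigidity
  proofs for \<open>k > s + 1\<close> glue local constancy in this way.\<close>

lemma constant_on_chain:
  fixes a b :: nat
  assumes "a \<le> b" "\<And>i. a \<le> i \<Longrightarrow> i \<le> b \<Longrightarrow> g constant_on B i"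
    and "\<And>i. a \<le> i \<Longrightarrow> i < b \<Longrightarrow> B i \<inter> B (Suc i) \<noteq> {}"
  shows "g constant_on (\<Union>i\<in>{a..b}. B i)"
  using assms
proof (induction b rule: dec_induct)
  case base
  then show ?case by simp
next
  case (step m)
  have "g constant_on (\<Union>i\<in>{a..m}. B i)" using step by simp
  moreover have "(\<Union>i\<in>{a..m}. B i) \<inter> B (Suc m) \<noteq> {}" using step.prems(2)[of m] step.hyps by fastforce
  moreover have "(\<Union>i\<in>{a..Suc m}. B i) = (\<Union>i\<in>{a..m}. B i) \<union> B (Suc m)"
    using step.hyps by (auto simp: atLeastAtMostSuc_conv)
  moreover have "g constant_on B (Suc m)" using step by simp
  ultimately show ?case using constant_on_Un by metis
qed

lemma UN_lam:
  assumes "a \<le> b" "s \<le> k"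
  shows "(\<Union>i\<in>{a..b}. lam k s i) = {s * a..<s * b + k}"
  using assms
proof (induction b rule: dec_induct)
  case base
  then show ?case by (simp add: lam_def)
next
  case (step m)
  have "s * a \<le> s * m" using step.hyps by simp
  moreover have "(\<Union>i\<in>{a..Suc m}. lam k s i) = {s * a..<s * m + k} \<union> lam k s (Suc m)"
    using step by (auto simp: atLeastAtMostSuc_conv)
  moreover have "x \<in> {s * a..<s * m + k} \<union> lam k s (Suc m) \<longleftrightarrow> x \<in> {s * a..<s * Suc m + k}" for x
    using \<open>s * a \<le> s * m\<close> step.prems
    unfolding Un_iff atLeastLessThan_iff mem_lam_iff mult_Suc_right by linarith
  ultimately show ?case by blast
qed

section \<open>Weights that are indicators of index sets\<close>

lemma minimizers_indicator:
  "minimizers (\<lambda>x. of_bool (x \<in> S)) L = (if L \<subseteq> S then L else L - S)"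
  by (auto simp: minimizers_def)

text \<open>Positive scaling and adding a constant preserve the order of values, and
  \<open>S\<close> is recovered as the set where the larger value is taken. This value differs from
  the other because \<open>S\<close> is nonempty and proper.\<close>

lemma indicator_constant_on_imp_eq:
  fixes \<alpha> :: real
  assumes "S \<noteq> {}" "S \<subset> X" "T \<subset> X" "\<alpha> > 0"
    and "(\<lambda>x. of_bool (x \<in> S) - \<alpha> * of_bool (x \<in> T)) constant_on X"
  shows "S = T"
proof (rule ccontr)
  assume "S \<noteq> T"
  note D = constant_onD[OF assms(5)]
  obtain y z where yz: "y \<in> S" "z \<in> X" "z \<notin> S" using assms by blast
  consider x where "x \<in> S" "x \<notin> T" | x where "x \<in> T" "x \<notin> S" using \<open>S \<noteq> T\<close> by blast
  then show False
  proof cases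
    case 1
    then show False using D[of x z] yz assms(2,4) by (cases "z \<in> T") auto
  next
    case 2
    then show False using D[of x y] yz assms(2,3,4) by (cases "y \<in> T") auto
  qed
qed

context
  fixes n k s :: nat
  assumes n: "n > 0" and s: "s > 0" and k: "k > s + 1"
begin

abbreviation (input) "K \<equiv> s * (n - 1) + k"

lemma UN_all_lam: "(\<Union>i\<in>{0..n - 1}. lam k s i) = {..<K}"
  using UN_lam[of 0 "n - 1" s k] k by auto

text \<open>Neighbouring \<open>lam\<close> sets share the index \<open>s * Suc i\<close>, so local
  constants agree and weights are equivalent up to one global constant.\<close>

lemma constant_on_lam_iff: "(\<forall>i<n. h constant_on lam k s i) \<longleftrightarrow> h constant_on {..<K}"
proof
  assume h: "\<forall>i<n. h constant_on lam k s i"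
  have "h constant_on (\<Union>i\<in>{0..n - 1}. lam k s i)"
  proof (rule constant_on_chain)
    fix i
    have "s * Suc i \<in> lam k s i \<inter> lam k s (Suc i)" using k by (simp add: mem_lam_iff)
    then show "lam k s i \<inter> lam k s (Suc i) \<noteq> {}" by blast
  qed (use h n in auto)
  then show "h constant_on {..<K}" by (simp only: UN_all_lam)
next
  assume "h constant_on {..<K}"
  then show "\<forall>i<n. h constant_on lam k s i"
    using lam_subset constant_on_subset by metis
qed

text \<open>A function is a multiple of the indicator of \<open>S\<close> plus a constant exactly
  when it is constant on \<open>S\<close> and on its complement; the factor is the jump between the
  two values.\<close>

lemma facet_weight_indicatorI:
  assumes S: "S \<noteq> {}" "S \<subset> {..<K}"
    and const: "\<And>g :: nat \<Rightarrow> real.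
      (\<And>i. i < n \<Longrightarrow> g constant_on (if lam k s i \<subseteq> S then lam k s i else lam k s i - S)) \<Longrightarrow>
      g constant_on S \<and> g constant_on {..<K} - S"
  shows "facet_weight n k s (\<lambda>x. of_bool (x \<in> S))"
proof -
  obtain a b where ab: "a \<in> S" "b \<in> {..<K} - S" using S by blast
  have "\<not> (\<lambda>x. of_bool (x \<in> S) :: real) constant_on {..<K}"
    using ab S(2) constant_onD[of "\<lambda>x. of_bool (x \<in> S) :: real" "{..<K}" a b] by auto
  moreover have "\<exists>\<alpha>. (\<lambda>x. g x - \<alpha> * of_bool (x \<in> S)) constant_on {..<K}"
    if "\<forall>i<n. g constant_on minimizers (\<lambda>x. of_bool (x \<in> S)) (lam k s i)" for g :: "nat \<Rightarrow> real"
  proof -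
    have g: "g constant_on S" "g constant_on {..<K} - S"
      using const[of g] that by (auto simp: minimizers_indicator)
    have "g x - (g a - g b) * of_bool (x \<in> S) = g b" if "x \<in> {..<K}" for x
      using constant_onD[OF g(1) _ ab(1), of x] constant_onD[OF g(2) _ ab(2), of x] that
      by (cases "x \<in> S") auto
    then show ?thesis unfolding constant_on_def by blast
  qed
  ultimately show ?thesis
    unfolding facet_weight_def constant_on_lam_iff using constant_on_lam_iff by blast
qed

text \<open>The converse, by which well-chosen test functions \<open>g\<close> restrict the shape of
  \<open>S\<close>.\<close>

lemma facet_weight_indicatorD:
  assumes facet: "facet_weight n k s (\<lambda>x. of_bool (x \<in> S))" and "S \<subseteq> {..<K}"
    and g: "\<And>i. i < n \<Longrightarrow> (g :: nat \<Rightarrow> real) constant_on (if lam k s i \<subseteq> S then lam k s i else lam k s i - S)"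
  shows "g constant_on S" "g constant_on {..<K} - S"
proof -
  obtain \<alpha> where "(\<lambda>x. g x - \<alpha> * of_bool (x \<in> S)) constant_on {..<K}"
    using facet g unfolding facet_weight_def constant_on_lam_iff minimizers_indicator by blast
  then obtain c where "\<And>x. x \<in> {..<K} \<Longrightarrow> g x - \<alpha> * of_bool (x \<in> S) = c"
    unfolding constant_on_def by blast
  then have "g x = c + \<alpha> * of_bool (x \<in> S)" if "x \<in> {..<K}" for x
    using that by (metis diff_add_cancel add.commute)
  then show "g constant_on S" "g constant_on {..<K} - S"
    using \<open>S \<subseteq> {..<K}\<close> by (auto intro!: constant_onI simp: subset_iff)
qed

text \<open>The ranges stop short of \<open>b = n - 1\<close> and \<open>a = 0\<close>, for which
  the prefix or suffix would be all of \<open>{..<K}\<close>.\<close>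

definition facet_sets :: "nat set set" where
  "facet_sets = (\<lambda>j. {j}) ` {..<K} \<union> (\<lambda>b. {..<s * b + k}) ` {..<n - 1} \<union>
     (\<lambda>a. {s * a..<K}) ` {1..<n}"

text \<open>Because \<open>k > s + 1\<close>, neighbouring \<open>lam\<close> sets share at least
  two indices, so they still overlap after \<open>j\<close> is removed.\<close>

lemma facet_weight_singleton:
  assumes "j < K"
  shows "facet_weight n k s (\<lambda>x. of_bool (x \<in> {j}))"
proof (rule facet_weight_indicatorI)
  show "{j} \<subset> {..<K}"
  proof -
    have "(if j = 0 then 1 else 0) \<in> {..<K} - {j}" using k by auto
    then show ?thesis using assms by auto
  qed
next
  fix g :: "nat \<Rightarrow> real"
  assume g: "g constant_on (if lam k s i \<subseteq> {j} then lam k s i else lam k s i - {j})" if "i < n" for i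
  have "g constant_on (\<Union>i\<in>{0..n - 1}. lam k s i - {j})"
  proof (rule constant_on_chain)
    fix i assume "i \<le> n - 1"
    have "s * i \<in> lam k s i" "s * i + 1 \<in> lam k s i" using k by (auto simp: mem_lam_iff)
    then have "\<not> lam k s i \<subseteq> {j}" by (metis Suc_eq_plus1 n_not_Suc_n singletonD subsetD)
    then show "g constant_on lam k s i - {j}" using g[of i] \<open>i \<le> n - 1\<close> n by simp
  next
    fix i
    have "s * Suc i \<in> lam k s i \<inter> lam k s (Suc i)" "s * Suc i + 1 \<in> lam k s i \<inter> lam k s (Suc i)"
      using k by (auto simp: mem_lam_iff)
    moreover have "s * Suc i \<noteq> j \<or> s * Suc i + 1 \<noteq> j" by simp
    ultimately show "(lam k s i - {j}) \<inter> (lam k s (Suc i) - {j}) \<noteq> {}" by blast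
  qed simp
  also have "(\<Union>i\<in>{0..n - 1}. lam k s i - {j}) = {..<K} - {j}"
    using UN_all_lam by blast
  finally show "g constant_on {j} \<and> g constant_on {..<K} - {j}"
    by (simp add: constant_on_def)
qed simp

text \<open>The sets up to index \<open>b\<close> lie inside the prefix and chain together. Each
  later one sticks out of it, and the parts sticking out chain together as well.\<close>

lemma facet_weight_prefix:
  assumes "b < n - 1"
  shows "facet_weight n k s (\<lambda>x. of_bool (x \<in> {..<s * b + k}))" (is "facet_weight n k s (\<lambda>x. of_bool (x \<in> ?S))")
proof (rule facet_weight_indicatorI)
  show "?S \<noteq> {}" using k by (simp add: lessThan_empty_iff)
  have "s * b < s * (n - 1)" using assms s by (rule mult_less_mono2)
  then have "s * b + k < K" by linarith
  then show "?S \<subset> {..<K}" by auto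
next
  fix g :: "nat \<Rightarrow> real"
  assume g: "g constant_on (if lam k s i \<subseteq> ?S then lam k s i else lam k s i - ?S)" if "i < n" for i
  have "g constant_on (\<Union>i\<in>{0..b}. lam k s i)"
  proof (rule constant_on_chain)
    fix i assume "i \<le> b"
    then have "s * i \<le> s * b" by simp
    then have "x \<in> ?S" if "x \<in> lam k s i" for x
      using that unfolding mem_lam_iff lessThan_iff by linarith
    then have "lam k s i \<subseteq> ?S" by blast
    then show "g constant_on lam k s i" using g[of i] assms \<open>i \<le> b\<close> by simp
  next
    fix i
    have "s * Suc i \<in> lam k s i \<inter> lam k s (Suc i)" using k by (simp add: mem_lam_iff)
    then show "lam k s i \<inter> lam k s (Suc i) \<noteq> {}" by blast
  qed simp
  then have "g constant_on ?S"
    using UN_lam[of 0 b s k] k by (simp add: atLeast0LessThan)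
  moreover have "g constant_on (\<Union>i\<in>{Suc b..n - 1}. lam k s i - ?S)"
  proof (rule constant_on_chain)
    fix i assume i: "Suc b \<le> i" "i \<le> n - 1"
    then have "s * Suc b \<le> s * i" by (intro mult_le_mono2) simp
    then have "s * i + (k - 1) \<in> lam k s i - ?S" using k s by (simp add: mem_lam_iff) linarith
    then have "\<not> lam k s i \<subseteq> ?S" by blast
    moreover have "i < n" using i n by linarith
    ultimately show "g constant_on lam k s i - ?S" using g[of i] by simp
  next
    fix i assume i: "Suc b \<le> i"
    then have "s * Suc b \<le> s * i" by (intro mult_le_mono2) simp
    \<comment> \<open>The last index of \<open>lam k s i\<close> lies beyond the prefix and still
      belongs to the next set.\<close>
    then have "s * i + (k - 1) \<in> (lam k s i - ?S) \<inter> (lam k s (Suc i) - ?S)"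
      using k s by (simp add: mem_lam_iff) linarith
    then show "(lam k s i - ?S) \<inter> (lam k s (Suc i) - ?S) \<noteq> {}" by blast
  qed (use assms in simp)
  moreover have "(\<Union>i\<in>{Suc b..n - 1}. lam k s i - ?S) = {..<K} - ?S"
  proof -
    have "(\<Union>i\<in>{Suc b..n - 1}. lam k s i - ?S) = {s * Suc b..<K} - ?S"
      using UN_lam[of "Suc b" "n - 1" s k] assms k by auto
    also have "\<dots> = {..<K} - ?S" using k by auto
    finally show ?thesis .
  qed
  ultimately show "g constant_on ?S \<and> g constant_on {..<K} - ?S" by simp
qed

text \<open>The mirror image of the prefix case: the sets before index \<open>a\<close> start
  outside the suffix, and neighbours among them share the first index of the later one.\<close>

lemma facet_weight_suffix:
  assumes "1 \<le> a" "a < n"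
  shows "facet_weight n k s (\<lambda>x. of_bool (x \<in> {s * a..<K}))" (is "facet_weight n k s (\<lambda>x. of_bool (x \<in> ?S))")
proof (rule facet_weight_indicatorI)
  have a: "s * a \<le> s * (n - 1)" using assms by (intro mult_le_mono2) simp
  then have "s * a < K" using k by linarith
  then have "s * a \<in> ?S" by simp
  then show "?S \<noteq> {}" by blast
  have "0 \<in> {..<K}" "0 \<notin> ?S" using s assms k by auto
  moreover have "?S \<subseteq> {..<K}" by auto
  ultimately show "?S \<subset> {..<K}" by blast
next
  fix g :: "nat \<Rightarrow> real"
  assume g: "g constant_on (if lam k s i \<subseteq> ?S then lam k s i else lam k s i - ?S)" if "i < n" for i
  have a: "s * a \<le> s * (n - 1)" using assms by (intro mult_le_mono2) simp
  have "g constant_on (\<Union>i\<in>{a..n - 1}. lam k s i)"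
  proof (rule constant_on_chain)
    fix i assume i: "a \<le> i" "i \<le> n - 1"
    then have "s * a \<le> s * i" "s * i \<le> s * (n - 1)" by (simp_all only: mult_le_mono2)
    then have "x \<in> ?S" if "x \<in> lam k s i" for x
      using that unfolding mem_lam_iff atLeastLessThan_iff by linarith
    then have "lam k s i \<subseteq> ?S" by blast
    then show "g constant_on lam k s i" using g[of i] n i by simp
  next
    fix i
    have "s * Suc i \<in> lam k s i \<inter> lam k s (Suc i)" using k by (simp add: mem_lam_iff)
    then show "lam k s i \<inter> lam k s (Suc i) \<noteq> {}" by blast
  qed (use assms in simp)
  then have "g constant_on ?S"
    using UN_lam[of a "n - 1" s k] k assms by simp
  moreover have "g constant_on (\<Union>i\<in>{0..a - 1}. lam k s i - ?S)"
  proof (rule constant_on_chain)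
    fix i assume i: "i \<le> a - 1"
    then have "i < a" using assms by linarith
    then have "s * i \<in> lam k s i - ?S" using k s by (simp add: mem_lam_iff)
    then have "\<not> lam k s i \<subseteq> ?S" by blast
    moreover have "i < n" using i assms by linarith
    ultimately show "g constant_on lam k s i - ?S" using g[of i] by simp
  next
    fix i assume i: "i < a - 1"
    then have "s * Suc i < s * a" using s by (intro mult_less_mono2) simp_all
    then have "s * Suc i \<notin> ?S" by simp
    moreover have "s * Suc i \<in> lam k s i" "s * Suc i \<in> lam k s (Suc i)"
      using k by (simp_all add: mem_lam_iff)
    ultimately have "s * Suc i \<in> (lam k s i - ?S) \<inter> (lam k s (Suc i) - ?S)" by blast
    then show "(lam k s i - ?S) \<inter> (lam k s (Suc i) - ?S) \<noteq> {}" by blast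
  qed simp
  moreover have "(\<Union>i\<in>{0..a - 1}. lam k s i - ?S) = {..<K} - ?S"
  proof -
    \<comment> \<open>Since \<open>k > s\<close>, the set with index \<open>a - 1\<close> reaches
      past \<open>s * a\<close>, so the union leaves no gap below the suffix.\<close>
    have "s * a = s * (a - 1) + s" using assms by (cases a) auto
    then have "{..<s * (a - 1) + k} - ?S = {..<K} - ?S" using k a by auto
    moreover have "(\<Union>i\<in>{0..a - 1}. lam k s i - ?S) = {..<s * (a - 1) + k} - ?S"
      using UN_lam[of 0 "a - 1" s k] k by auto
    ultimately show ?thesis by simp
  qed
  ultimately show "g constant_on ?S \<and> g constant_on {..<K} - ?S" by simp
qed

text \<open>Unless \<open>S\<close> is a singleton, rigidity makes it a union of \<open>lam\<close>
  sets and an interval containing 0 or \<open>K - 1\<close>. Its other end must then be an end of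
  one of these sets.\<close>

lemma facet_sets_complete:
  assumes facet: "facet_weight n k s (\<lambda>x. of_bool (x \<in> S))"
    and S: "S \<noteq> {}" "S \<subset> {..<K}"
  shows "S \<in> facet_sets"
proof -
  note D = facet_weight_indicatorD[OF facet]
  have sub: "S \<subseteq> {..<K}" using S by blast
  have fin: "finite S" using sub finite_subset by blast
  show ?thesis
  proof (cases "\<exists>j. S = {j}")
    case True
    then show ?thesis using sub by (auto simp: facet_sets_def)
  next
    case False
    txt \<open>Each of the next three claims exhibits a weight that is constant on all the minimizing sets
      but, if the claim fails, is not constant on \<open>S\<close> or on its complement.\<close>
    have cover: "\<exists>i<n. x \<in> lam k s i \<and> lam k s i \<subseteq> S" if x: "x \<in> S" for x
    proof (rule ccontr)
      assume neg: "\<not> ?thesis"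
      \<comment> \<open>If no \<open>lam\<close> set inside \<open>S\<close> contains
        \<open>x\<close>, this indicator vanishes on every minimizing set.\<close>
      have "(\<lambda>y. of_bool (y = x) :: real) constant_on S"
      proof (rule D(1)[OF sub])
        fix i assume "i < n"
        then have "of_bool (y = x) = (0 :: real)"
          if "y \<in> (if lam k s i \<subseteq> S then lam k s i else lam k s i - S)" for y
          using that x neg by (auto split: if_splits)
        then show "(\<lambda>y. of_bool (y = x) :: real) constant_on
            (if lam k s i \<subseteq> S then lam k s i else lam k s i - S)"
          unfolding constant_on_def by blast
      qed
      then have "y = x" if "y \<in> S" for y using constant_onD[OF _ x that] by fastforce
      then have "S = {x}" using x by blast
      with False show False by blast
    qed
    have interval: "y \<in> S" if "x < y" "y < z" "x \<in> S" "z \<in> S" for x y z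
    proof (rule ccontr)
      assume y: "y \<notin> S"
      \<comment> \<open>A \<open>lam\<close> set inside \<open>S\<close> is an interval avoiding
        \<open>y\<close>, so it lies on one side of \<open>y\<close>. The remaining minimizing sets
        avoid \<open>S\<close>, where \<open>?g\<close> is 0.\<close>
      let ?g = "\<lambda>u. of_bool (u \<in> S \<and> u < y) :: real"
      have "?g constant_on S"
      proof (rule D(1)[OF sub], rule constant_onI)
        fix i p q
        assume p: "p \<in> (if lam k s i \<subseteq> S then lam k s i else lam k s i - S)"
          and q: "q \<in> (if lam k s i \<subseteq> S then lam k s i else lam k s i - S)"
        show "?g p = ?g q"
        proof (cases "lam k s i \<subseteq> S")
          case True
          then have "y \<notin> lam k s i" using y by blast
          then show ?thesis using True p q by (auto simp: mem_lam_iff)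
        qed (use p q in auto)
      qed
      then have "?g x = ?g z" using that by (blast dest: constant_onD)
      then show False using that by simp
    qed
    have cointerval: False if "x < y" "y < z" "x \<notin> S" "z \<notin> S" "y \<in> S" "z < K" for x y z
    proof -
      obtain i where i: "y \<in> lam k s i" "lam k s i \<subseteq> S" using cover[OF \<open>y \<in> S\<close>] by blast
      let ?g = "\<lambda>u. of_bool (u \<notin> S \<and> u < y) :: real"
      have "?g constant_on {..<K} - S"
      proof (rule D(2)[OF sub], rule constant_onI)
        fix i' p q
        assume p: "p \<in> (if lam k s i' \<subseteq> S then lam k s i' else lam k s i' - S)"
          and q: "q \<in> (if lam k s i' \<subseteq> S then lam k s i' else lam k s i' - S)"
        show "?g p = ?g q"
        proof (cases "lam k s i' \<subseteq> S")
          case False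
          then have pq: "p \<in> lam k s i'" "q \<in> lam k s i'" "p \<notin> S" "q \<notin> S" using p q by auto
          then have "p \<notin> lam k s i" "q \<notin> lam k s i" using i by auto
          \<comment> \<open>Indices outside \<open>S\<close> on different sides of \<open>y\<close>
            are separated by the \<open>k\<close> consecutive indices of \<open>lam k s i\<close>,
            too far apart to share another \<open>lam\<close> set.\<close>
          then have "p < y \<longleftrightarrow> q < y" using pq(1,2) i(1) unfolding mem_lam_iff by linarith
          then show ?thesis using pq by simp
        qed (use p q in auto)
      qed
      then have "?g x = ?g z" using that by (intro constant_onD[where A = "{..<K} - S"]) auto
      then show False using that by simp
    qed
    obtain y where y: "y \<in> S" using S by blast
    have "0 \<in> S \<or> K - 1 \<in> S"
    proof (rule ccontr)
      assume neg: "\<not> ?thesis"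
      have "y \<noteq> 0" "y \<noteq> K - 1" "y < K" using y sub neg by (metis, metis, blast)
      then have "0 < y" "y < K - 1" by linarith+
      then show False using cointerval[of 0 y "K - 1"] neg y k by auto
    qed
    then show ?thesis
    proof
      assume 0: "0 \<in> S"
      define q where "q = Max S"
      have q: "q \<in> S" "\<And>x. x \<in> S \<Longrightarrow> x \<le> q" using fin S by (auto simp: q_def)
      have Sq: "S = {..<Suc q}"
      proof (intro equalityI subsetI)
        fix x assume "x \<in> {..<Suc q}"
        then show "x \<in> S" using interval[of 0 x q] 0 q by (cases "x = 0 \<or> x = q") auto
      qed (use q in \<open>auto simp: less_Suc_eq_le\<close>)
      obtain b where b: "b < n" "q \<in> lam k s b" "lam k s b \<subseteq> S" using cover[OF q(1)] by blast
      \<comment> \<open>The set containing the maximum \<open>q\<close> lies in \<open>S\<close>, so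
        \<open>q\<close> must be its last index.\<close>
      have "s * b + k - 1 \<in> S" using b(3) k by (auto simp: mem_lam_iff subset_iff)
      then have eq: "Suc q = s * b + k" using b(2) q(2) k by (fastforce simp: mem_lam_iff)
      have "b \<noteq> n - 1" using S(2) Sq eq by auto
      then show ?thesis using Sq eq b(1) by (auto simp: facet_sets_def)
    next
      assume top: "K - 1 \<in> S"
      define p where "p = Min S"
      have p: "p \<in> S" "\<And>x. x \<in> S \<Longrightarrow> p \<le> x" using fin S by (auto simp: p_def)
      have Sp: "S = {p..<K}"
      proof (intro equalityI subsetI)
        fix x assume "x \<in> {p..<K}"
        then show "x \<in> S" using interval[of p x "K - 1"] top p by (cases "x = p \<or> x = K - 1") auto
      qed (use p sub in auto)
      obtain a where a: "a < n" "p \<in> lam k s a" "lam k s a \<subseteq> S" using cover[OF p(1)] by blast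
      have "s * a \<in> S" using a(3) k by (auto simp: mem_lam_iff subset_iff)
      then have eq: "p = s * a" using a(2) p(2) by (fastforce simp: mem_lam_iff)
      have "a \<noteq> 0" using S(2) Sp eq by (auto simp: atLeast0LessThan)
      then show ?thesis using Sp eq a(1) by (auto simp: facet_sets_def)
    qed
  qed
qed

text \<open>Let \<open>S\<close> collect the indices where \<open>f\<close> exceeds its global
  minimum. As \<open>f\<close> is constant on each minimizing set, so is the indicator of
  \<open>S\<close>, and rigidity makes this indicator a multiple of \<open>f\<close> plus a
  constant.\<close>

lemma facet_weight_complete:
  assumes f: "facet_weight n k s f"
  obtains S \<alpha> where "S \<noteq> {}" "S \<subset> {..<K}" "\<alpha> > 0"
    "(\<lambda>x. f x - \<alpha> * of_bool (x \<in> S)) constant_on {..<K}"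
    "facet_weight n k s (\<lambda>x. of_bool (x \<in> S))"
proof -
  have nonconst: "\<not> f constant_on {..<K}"
    and D: "\<And>g. \<forall>i<n. g constant_on minimizers f (lam k s i) \<Longrightarrow>
      \<exists>\<alpha>. (\<lambda>x. g x - \<alpha> * f x) constant_on {..<K}"
    using f constant_on_lam_iff unfolding facet_weight_def by blast+
  define m where "m = Min (f ` {..<K})"
  have m_le: "m \<le> f x" if "x < K" for x using that by (simp add: m_def)
  have "m \<in> f ` {..<K}" unfolding m_def using k by (intro Min_in) (auto simp: lessThan_empty_iff)
  then obtain b where b: "b < K" "f b = m" by auto
  define S where "S = {x. x < K \<and> m < f x}"
  obtain a where a: "a \<in> S"
    using nonconst m_le unfolding S_def constant_on_def by (metis lessThan_iff mem_Collect_eq order_le_less)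
  have S: "S \<noteq> {}" "S \<subset> {..<K}" using a b by (auto simp: S_def)
  have "(\<lambda>x. of_bool (x \<in> S) :: real) constant_on minimizers f (lam k s i)" if "i < n" for i
  proof (rule constant_onI)
    fix x y assume "x \<in> minimizers f (lam k s i)" "y \<in> minimizers f (lam k s i)"
    then have "f x = f y" "x < K" "y < K" using lam_subset[OF that, of k s]
      by (auto simp: minimizers_def intro: antisym)
    then show "of_bool (x \<in> S) = (of_bool (y \<in> S) :: real)" by (simp add: S_def)
  qed
  then obtain \<beta> where \<beta>: "(\<lambda>x. of_bool (x \<in> S) - \<beta> * f x) constant_on {..<K}"
    using D by blast
  \<comment> \<open>Comparing \<open>a\<close>, above the minimum, with \<open>b\<close>, where it
    is attained, gives \<beta> > 0.\<close>
  have "of_bool (a \<in> S) - \<beta> * f a = of_bool (b \<in> S) - \<beta> * f b"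
    using constant_onD[OF \<beta>, of a b] a b by (simp add: S_def)
  then have "\<beta> * (f a - m) = 1" using a b by (simp add: S_def right_diff_distrib)
  moreover have "f a - m > 0" using a by (simp add: S_def)
  ultimately have "\<beta> > 0" by (metis zero_less_mult_pos2 zero_less_one)
  have const: "(\<lambda>x. f x - 1 / \<beta> * of_bool (x \<in> S)) constant_on {..<K}"
    using scaled_constant_on[OF \<beta>] \<open>\<beta> > 0\<close> by simp
  then obtain c where "\<And>x. x \<in> {..<K} \<Longrightarrow> f x - 1 / \<beta> * of_bool (x \<in> S) = c"
    unfolding constant_on_def by blast
  then have f_eq: "f x = c + 1 / \<beta> * of_bool (x \<in> S)" if "x < K" for x
    using that by (metis diff_add_cancel lessThan_iff)
  \<comment> \<open>An increasing affine change of values keeps the minimizing sets, so rigidity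
    passes from \<open>f\<close> to the indicator.\<close>
  have min: "minimizers f (lam k s i) = minimizers (\<lambda>x. of_bool (x \<in> S)) (lam k s i)" if "i < n" for i
  proof -
    have "f x \<le> f y \<longleftrightarrow> of_bool (x \<in> S) \<le> (of_bool (y \<in> S) :: real)"
      if "x \<in> lam k s i" "y \<in> lam k s i" for x y
      using that lam_subset[OF \<open>i < n\<close>, of k s] f_eq[of x] f_eq[of y] \<open>\<beta> > 0\<close>
      by (auto simp: subset_iff)
    then show ?thesis by (auto simp: minimizers_def)
  qed
  have "facet_weight n k s (\<lambda>x. of_bool (x \<in> S))"
  proof (rule facet_weight_indicatorI[OF S])
    fix g :: "nat \<Rightarrow> real"
    assume "g constant_on (if lam k s i \<subseteq> S then lam k s i else lam k s i - S)" if "i < n" for i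
    then have "\<forall>i<n. g constant_on minimizers f (lam k s i)"
      by (simp add: min minimizers_indicator)
    then obtain \<alpha> where "(\<lambda>x. g x - \<alpha> * f x) constant_on {..<K}" using D by blast
    then obtain d where "\<And>x. x \<in> {..<K} \<Longrightarrow> g x - \<alpha> * f x = d"
      unfolding constant_on_def by blast
    then have g_eq: "g x = d + \<alpha> * (c + 1 / \<beta> * of_bool (x \<in> S))" if "x < K" for x
      using that f_eq[OF that] by (metis diff_add_cancel lessThan_iff)
    show "g constant_on S \<and> g constant_on {..<K} - S"
      using S(2) by (auto intro!: constant_onI simp: g_eq subset_iff psubset_eq)
  qed
  then show ?thesis using that[OF S _ const] \<open>\<beta> > 0\<close> by simp
qed

section \<open>Counting the facet sets\<close>

lemma facet_sets_proper:
  assumes "S \<in> facet_sets"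
  shows "facet_weight n k s (\<lambda>x. of_bool (x \<in> S))" "S \<noteq> {}" "S \<subset> {..<K}"
proof -
  show *: "facet_weight n k s (\<lambda>x. of_bool (x \<in> S))"
    using assms facet_weight_singleton facet_weight_prefix facet_weight_suffix
    by (auto simp only: facet_sets_def Un_iff image_iff lessThan_iff atLeastLessThan_iff)
  \<comment> \<open>Nonconstancy of a facet weight excludes the empty and the full set at
    once.\<close>
  have "\<not> (\<lambda>x. of_bool (x \<in> S) :: real) constant_on {..<K}"
    using * constant_on_lam_iff[of "\<lambda>x. of_bool (x \<in> S)"] unfolding facet_weight_def by blast
  then have "S \<noteq> {}" "S \<noteq> {..<K}"
    using constant_onI[of "{..<K}" "\<lambda>x. of_bool (x \<in> S) :: real"] by auto
  moreover have "S \<subseteq> {..<K}" using assms by (auto simp: facet_sets_def intro: less_le_trans)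
  ultimately show "S \<noteq> {}" "S \<subset> {..<K}" by auto
qed

text \<open>The K singletons, \<open>n - 1\<close> prefixes and \<open>n - 1\<close> suffixes are
  all distinct: prefixes and suffixes have at least \<open>k > 1\<close> elements, and only prefixes
  among these two contain 0.\<close>

lemma card_facet_sets: "card facet_sets = (s + 2) * (n - 1) + k"
proof -
  let ?A = "(\<lambda>j. {j}) ` {..<K}" and ?B = "(\<lambda>b. {..<s * b + k}) ` {..<n - 1}"
    and ?C = "(\<lambda>a. {s * a..<K}) ` {1..<n}"
  have aK: "s * a + k \<le> K" if "a < n" for a
    using that by (intro add_right_mono mult_le_mono2) simp
  have "card ?A = K" by (simp add: card_image)
  moreover have "card ?B = n - 1" using s by (subst card_image) (auto simp: inj_on_def)
  moreover have "card ?C = n - 1"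
  proof (subst card_image)
    show "inj_on (\<lambda>a. {s * a..<K}) {1..<n}"
    proof
      fix a a' assume a: "a \<in> {1..<n}" "a' \<in> {1..<n}" "{s * a..<K} = {s * a'..<K}"
      moreover have "s * a + k \<le> K" "s * a' + k \<le> K" using a by (auto intro!: aK simp only: atLeastLessThan_iff)
      then have "s * a < K" "s * a' < K" using k by linarith+
      ultimately have "s * a = s * a'" by (metis atLeastLessThan_eq_iff)
      then show "a = a'" using s by simp
    qed
  qed simp
  moreover have "?A \<inter> ?B = {}"
  proof -
    have "{j} \<noteq> {..<s * b + k}" for j b
    proof
      assume "{j} = {..<s * b + k}"
      then have "card {..<s * b + k} = 1" by (metis card_1_singleton_iff One_nat_def)
      then show False using k by simp
    qed
    then show ?thesis by blast
  qed
  moreover have "(?A \<union> ?B) \<inter> ?C = {}"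
  proof -
    have "{j} \<noteq> {s * a..<K}" if "a < n" for j a
    proof
      assume "{j} = {s * a..<K}"
      then have "K - s * a = 1" by (metis card_1_singleton_iff One_nat_def card_atLeastLessThan)
      then show False using k aK[OF that] by linarith
    qed
    moreover have "{..<s * b + k} \<noteq> {s * a..<K}" if "1 \<le> a" for a b
    proof -
      have "0 \<in> {..<s * b + k}" "0 \<notin> {s * a..<K}" using k s that by auto
      then show ?thesis by blast
    qed
    ultimately show ?thesis by fastforce
  qed
  ultimately have "card facet_sets = K + (n - 1) + (n - 1)"
    unfolding facet_sets_def by (simp add: card_Un_disjoint)
  then show ?thesis by (simp add: add_mult_distrib)
qed

end

theorem theorem1p3:
  fixes n k s :: nat and v :: "nat \<Rightarrow> 'm::finite"
  assumes "n > 0" and "k > 0" and "s > 0"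
    and "bij_betw v {..<s * (n - 1) + k} (UNIV :: 'm set)"
  shows "(k > s + 1 \<longrightarrow> card {F. F facet_of P_poly v n k s} = (s + 2) * (n - 1) + k) \<and>
         (1 < k \<and> k \<le> s + 1 \<longrightarrow> card {F. F facet_of P_poly v n k s} = k * n)"
proof (intro conjI impI)
  assume k: "k > s + 1"
  note ctx = \<open>n > 0\<close> \<open>s > 0\<close> k
  have "card {F. F facet_of P_poly v n k s} = card (facet_sets n k s)"
  proof (rule card_facets_P_poly[OF assms(2,4), where r = "\<lambda>S x. of_bool (x \<in> S)"])
    fix S assume "S \<in> facet_sets n k s"
    then show "facet_weight n k s (\<lambda>x. of_bool (x \<in> S))" by (rule facet_sets_proper(1)[OF ctx])
  next
    fix f assume "facet_weight n k s f"
    then obtain S \<alpha> where S: "S \<noteq> {}" "S \<subset> {..<s * (n - 1) + k}" "\<alpha> > 0"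
      "(\<lambda>x. f x - \<alpha> * of_bool (x \<in> S)) constant_on {..<s * (n - 1) + k}"
      "facet_weight n k s (\<lambda>x. of_bool (x \<in> S))"
      by (rule facet_weight_complete[OF ctx])
    have "S \<in> facet_sets n k s" by (rule facet_sets_complete[OF ctx S(5,1,2)])
    with S(3,4) show "\<exists>S\<in>facet_sets n k s. \<exists>\<alpha>>0.
        \<forall>i<n. (\<lambda>x. f x - \<alpha> * of_bool (x \<in> S)) constant_on lam k s i"
      unfolding constant_on_lam_iff[OF ctx] by (intro bexI[of _ S] exI[of _ \<alpha>] conjI)
  next
    fix S T and \<alpha> :: real
    assume "S \<in> facet_sets n k s" "T \<in> facet_sets n k s" "\<alpha> > 0"
      "\<forall>i<n. (\<lambda>x. of_bool (x \<in> S) - \<alpha> * of_bool (x \<in> T)) constant_on lam k s i"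
    then show "S = T"
      unfolding constant_on_lam_iff[OF ctx]
      using facet_sets_proper(2,3)[OF ctx] by (intro indicator_constant_on_imp_eq[of S _ T \<alpha>])
  qed
  then show "card {F. F facet_of P_poly v n k s} = (s + 2) * (n - 1) + k"
    by (simp only: card_facet_sets[OF ctx])
next
  assume k: "1 < k \<and> k \<le> s + 1"
  have "card {F. F facet_of P_poly v n k s} = card ({..<n} \<times> {..<k})"
  proof (rule card_facets_P_poly[OF assms(2,4), where r = "vertex_weight k s"])
    fix p assume "p \<in> {..<n} \<times> {..<k}"
    then show "facet_weight n k s (vertex_weight k s p)"
      using facet_weight_vertex_weight k by auto
  next
    fix f assume "facet_weight n k s f"
    then show "\<exists>p\<in>{..<n} \<times> {..<k}. \<exists>\<alpha>>0.
        \<forall>i<n. (\<lambda>x. f x - \<alpha> * vertex_weight k s p x) constant_on lam k s i"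
      using facet_weight_vertex_weight_complete k by blast
  next
    fix p q and \<alpha> :: real
    assume "p \<in> {..<n} \<times> {..<k}" "q \<in> {..<n} \<times> {..<k}" "\<alpha> > 0"
      "\<forall>i<n. (\<lambda>x. vertex_weight k s p x - \<alpha> * vertex_weight k s q x) constant_on lam k s i"
    then show "p = q"
      using vertex_weight_distinct[of k s "fst p" n "snd p" "snd q" \<alpha> "fst q"] k
      by (cases p; cases q) auto
  qed
  then show "card {F. F facet_of P_poly v n k s} = k * n" by simp
qed

end
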